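(* Let $A$ ($N\times N$) and $B$ ($M\times M$) be irreducible, non-permutation matrices with entries in $\{0,1\}$. If $A$ and $B$ are shift equivalent, then there is a group isomorphism $$\mathbb Z^N/(\mathrm{id}-A)\mathbb Z^N\otimes\mathbb Z^N/(\mathrm{id}-A^t)\mathbb Z^N\longrightarrow\mathbb Z^M/(\mathrm{id}-B)\mathbb Z^M\otimes\mathbb Z^M/(\mathrm{id}-B^t)\mathbb Z^M$$ carrying $e_A$ to $e_B$; i.e. the pair $(\mathbb Z^N/(\mathrm{id}-A)\mathbb Z^N\otimes\mathbb Z^N/(\mathrm{id}-A^t)\mathbb Z^N,\ e_A)$ is invariant under shift equivalence.
   Context: $e_i$ denotes the $i$-th standard basis column vector, $[\cdot]$ the class in the quotient, and $e_A=\sum_{i=1}^N[e_i]\otimes[e_i]\in\mathbb Z^N/(\mathrm{id}-A)\mathbb Z^N\otimes\mathbb Z^N/(\mathrm{id}-A^t)\mathbb Z^N$ (similarly $e_B$). Tensor products are over $\mathbb Z$. $A$ and $B$ are shift equivalent if there exist a positive integer $\ell$ and rectangular nonnegative integer matrices $R,S$ with $AR=RB$, $SA=BS$, $A^\ell=RS$, $B^\ell=SR$. *)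

theory Defs
  imports
    "HOL-Algebra.Free_Abelian_Groups"
    "HOL-Combinatorics.Permutations"
    "Jordan_Normal_Form.Matrix"
begin

text \<open>
  Matrix and vector indices range over \<open>0, \<dots>, N - 1\<close>. Abelian groups are written
  multiplicatively, following HOL-Algebra; the operation of \<open>monoid_vec TYPE(int) N\<close>, which is
  the group \<open>\<int>\<^sup>N\<close>, is addition of vectors.
\<close>

section \<open>Tensor product of abelian groups over the integers\<close>

text \<open>
  The free abelian group on \<open>carrier G \<times> carrier H\<close> modulo the biadditivity relations.
  Homogeneity in integer scalars follows from biadditivity.
\<close>

definition tensor_relations ::
    "('a, 'c) monoid_scheme \<Rightarrow> ('b, 'd) monoid_scheme \<Rightarrow> (('a \<times> 'b) \<Rightarrow>\<^sub>0 int) set" where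
  "tensor_relations G H =
     {frag_of (x \<otimes>\<^bsub>G\<^esub> x', y) - frag_of (x, y) - frag_of (x', y) | x x' y.
        x \<in> carrier G \<and> x' \<in> carrier G \<and> y \<in> carrier H} \<union>
     {frag_of (x, y \<otimes>\<^bsub>H\<^esub> y') - frag_of (x, y) - frag_of (x, y') | x y y'.
        x \<in> carrier G \<and> y \<in> carrier H \<and> y' \<in> carrier H}"

definition tensor_kernel ::
    "('a, 'c) monoid_scheme \<Rightarrow> ('b, 'd) monoid_scheme \<Rightarrow> (('a \<times> 'b) \<Rightarrow>\<^sub>0 int) set" where
  "tensor_kernel G H =
     generate (free_Abelian_group (carrier G \<times> carrier H)) (tensor_relations G H)"

definition tensor_group ::
    "('a, 'c) monoid_scheme \<Rightarrow> ('b, 'd) monoid_scheme \<Rightarrow> (('a \<times> 'b) \<Rightarrow>\<^sub>0 int) set monoid" where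
  "tensor_group G H = free_Abelian_group (carrier G \<times> carrier H) Mod tensor_kernel G H"

definition pure_tensor ::
    "('a, 'c) monoid_scheme \<Rightarrow> ('b, 'd) monoid_scheme \<Rightarrow> 'a \<Rightarrow> 'b \<Rightarrow> (('a \<times> 'b) \<Rightarrow>\<^sub>0 int) set" where
  "pure_tensor G H x y =
     tensor_kernel G H #>\<^bsub>free_Abelian_group (carrier G \<times> carrier H)\<^esub> frag_of (x, y)"

section \<open>The quotient groups and the distinguished element\<close>

definition id_minus_range :: "nat \<Rightarrow> int mat \<Rightarrow> int vec set" where
  "id_minus_range N A = (\<lambda>v. (1\<^sub>m N - A) *\<^sub>v v) ` carrier_vec N"

definition coker_group :: "nat \<Rightarrow> int mat \<Rightarrow> int vec set monoid" where
  "coker_group N A = monoid_vec TYPE(int) N Mod id_minus_range N A"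

definition coker_class :: "nat \<Rightarrow> int mat \<Rightarrow> int vec \<Rightarrow> int vec set" where
  "coker_class N A v = id_minus_range N A #>\<^bsub>monoid_vec TYPE(int) N\<^esub> v"

definition coker_tensor :: "nat \<Rightarrow> int mat \<Rightarrow> ((int vec set \<times> int vec set) \<Rightarrow>\<^sub>0 int) set monoid" where
  "coker_tensor N A = tensor_group (coker_group N A) (coker_group N A\<^sup>T)"

text \<open>\<open>finprod\<close> is the sum over \<open>i\<close>, as the tensor product is written multiplicatively.\<close>

definition e_elem :: "nat \<Rightarrow> int mat \<Rightarrow> ((int vec set \<times> int vec set) \<Rightarrow>\<^sub>0 int) set" where
  "e_elem N A =
     finprod (coker_tensor N A)
       (\<lambda>i. pure_tensor (coker_group N A) (coker_group N A\<^sup>T)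
              (coker_class N A (unit_vec N i)) (coker_class N A\<^sup>T (unit_vec N i)))
       {..<N}"

section \<open>Matrix conditions\<close>

definition irreducible_matrix :: "nat \<Rightarrow> int mat \<Rightarrow> bool" where
  "irreducible_matrix N A \<longleftrightarrow> (\<forall>i<N. \<forall>j<N. \<exists>k\<ge>1. (A ^\<^sub>m k) $$ (i, j) > 0)"

text \<open>For \<open>N = 0\<close> the empty matrix is a permutation matrix.\<close>

definition permutation_matrix :: "nat \<Rightarrow> int mat \<Rightarrow> bool" where
  "permutation_matrix N A \<longleftrightarrow>
     (\<exists>p. p permutes {..<N} \<and> A = mat N N (\<lambda>(i, j). if p i = j then 1 else 0))"

definition shift_equivalent :: "nat \<Rightarrow> int mat \<Rightarrow> nat \<Rightarrow> int mat \<Rightarrow> bool" where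
  "shift_equivalent N A M B \<longleftrightarrow>
     (\<exists>l R S. l \<ge> 1 \<and>
        R \<in> carrier_mat N M \<and> S \<in> carrier_mat M N \<and>
        elements_mat R \<subseteq> {0..} \<and> elements_mat S \<subseteq> {0..} \<and>
        A * R = R * B \<and> S * A = B * S \<and>
        A ^\<^sub>m l = R * S \<and> B ^\<^sub>m l = S * R)"

end

theory Submission
  imports Defs
begin

text \<open>
  A shift equivalence $(R, S)$ induces mutually inverse maps $[S], [R]$ between the cokernels of
  $\mathrm{id} - A$ and $\mathrm{id} - B$, and $[R^t], [S^t]$ between those of the transposes,
  because $RS = A^\ell$ and $SR = B^\ell$ act trivially on classes. The isomorphism
  $[S] \otimes [R^t]$ sends $e_A$ to
  $\sum_i [S e_i] \otimes [R^t e_i] = \sum_k [S R e_k] \otimes [e_k] =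
  \sum_k [B^\ell e_k] \otimes [e_k] = e_B$;
  the first equality moves $R$ across the tensor by biadditivity.
\<close>

section \<open>Finite products and homomorphisms\<close>

lemma hom_finprod:
  assumes "comm_group G" "comm_group K" "h \<in> hom G K" "finite A" "f \<in> A \<rightarrow> carrier G"
  shows "h (finprod G f A) = finprod K (\<lambda>i. h (f i)) A"
  using assms(4,5)
proof (induction A rule: finite_induct)
  case empty
  then show ?case
    using assms(1-3) by (simp add: comm_group_def hom_one comm_monoid.finprod_empty)
next
  case (insert a A)
  interpret G: comm_group G by fact
  interpret K: comm_group K by fact
  have "(\<lambda>i. h (f i)) \<in> A \<rightarrow> carrier K" "h (f a) \<in> carrier K"
    using insert.prems assms(3) by (auto simp: hom_def)
  with insert assms(3) show ?case
    by (simp add: hom_mult)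
qed

lemma (in comm_group) finprod_swap:
  assumes "finite A" "finite B" "\<And>i j. i \<in> A \<Longrightarrow> j \<in> B \<Longrightarrow> f i j \<in> carrier G"
  shows "(\<Otimes>i\<in>A. \<Otimes>j\<in>B. f i j) = (\<Otimes>j\<in>B. \<Otimes>i\<in>A. f i j)"
  using assms(1,3)
proof (induction A rule: finite_induct)
  case empty
  then show ?case by simp
next
  case (insert a A)
  have "(\<Otimes>i\<in>insert a A. \<Otimes>j\<in>B. f i j) = (\<Otimes>j\<in>B. f a j) \<otimes> (\<Otimes>j\<in>B. \<Otimes>i\<in>A. f i j)"
    using insert by (simp add: Pi_iff)
  also have "\<dots> = (\<Otimes>j\<in>B. f a j \<otimes> (\<Otimes>i\<in>A. f i j))"
    using insert.prems by (subst finprod_multf) (auto simp: Pi_iff)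
  also have "\<dots> = (\<Otimes>j\<in>B. \<Otimes>i\<in>insert a A. f i j)"
    using insert by (intro finprod_cong') (auto simp: Pi_iff)
  finally show ?case .
qed

lemma iso_of_inverse_homs:
  assumes "f \<in> hom G H" "g \<in> hom H G"
    and "\<And>x. x \<in> carrier G \<Longrightarrow> g (f x) = x" "\<And>y. y \<in> carrier H \<Longrightarrow> f (g y) = y"
  shows "f \<in> iso G H"
  using assms by (intro isoI bij_betw_byWitness[where f' = g]) (auto simp: hom_def)

section \<open>Tensor products\<close>

lemma tensor_relations_subset:
  assumes "group G" "group H"
  shows "tensor_relations G H \<subseteq> carrier (free_Abelian_group (carrier G \<times> carrier H))"
proof -
  interpret G: group G by fact
  interpret H: group H by fact
  \<comment> \<open>Both families of relations have the shape
    \<open>frag_of a - frag_of b - frag_of c\<close>, so a single bound on supports serves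
    additivity in either variable.\<close>
  have keys: "Poly_Mapping.keys (frag_of a - frag_of b - frag_of c) \<subseteq> S"
    if "a \<in> S" "b \<in> S" "c \<in> S" for a b c S
    using that keys_diff[of "frag_of a - frag_of b" "frag_of c"] keys_diff[of "frag_of a" "frag_of b"]
    by auto
  show ?thesis
  proof
    fix r assume "r \<in> tensor_relations G H"
    then obtain a b c where "r = frag_of a - frag_of b - frag_of c"
      "a \<in> carrier G \<times> carrier H" "b \<in> carrier G \<times> carrier H" "c \<in> carrier G \<times> carrier H"
      unfolding tensor_relations_def by auto
    then show "r \<in> carrier (free_Abelian_group (carrier G \<times> carrier H))"
      using keys by simp
  qed
qed

lemma normal_tensor_kernel:
  assumes "group G" "group H"
  shows "tensor_kernel G H \<lhd> free_Abelian_group (carrier G \<times> carrier H)"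
  unfolding tensor_kernel_def
  by (intro comm_group.subgroup_imp_normal[OF abelian_free_Abelian_group]
      group.generate_is_subgroup[OF group_free_Abelian_group] tensor_relations_subset assms)

lemma comm_group_tensor_group:
  assumes "group G" "group H"
  shows "comm_group (tensor_group G H)"
  unfolding tensor_group_def
  by (intro comm_group.abelian_FactGroup[OF abelian_free_Abelian_group] normal_imp_subgroup
      normal_tensor_kernel assms)

lemma tensor_quotient_hom:
  assumes "group G" "group H"
  shows "(\<lambda>c. tensor_kernel G H #>\<^bsub>free_Abelian_group (carrier G \<times> carrier H)\<^esub> c)
    \<in> hom (free_Abelian_group (carrier G \<times> carrier H)) (tensor_group G H)"
  unfolding tensor_group_def
  by (rule normal.r_coset_hom_Mod[OF normal_tensor_kernel[OF assms]])

lemma pure_tensor_closed: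
  assumes "group G" "group H" "x \<in> carrier G" "y \<in> carrier H"
  shows "pure_tensor G H x y \<in> carrier (tensor_group G H)"
  unfolding pure_tensor_def
  using assms by (intro hom_in_carrier[OF tensor_quotient_hom]) auto

text \<open>The coset map kills every relation z - x - y and is a homomorphism, so z and x + y have
  the same image. Pairs stay uncurried so that additivity in the left and in the right variable are
  both instances.\<close>

lemma pure_tensor_relation:
  assumes "group G" "group H" "x \<in> carrier G \<times> carrier H" "y \<in> carrier G \<times> carrier H"
    and "z \<in> carrier G \<times> carrier H"
    and "frag_of z - frag_of x - frag_of y \<in> tensor_relations G H"
  shows "case_prod (pure_tensor G H) z =
    case_prod (pure_tensor G H) x \<otimes>\<^bsub>tensor_group G H\<^esub> case_prod (pure_tensor G H) y"
proof -
  let ?F = "free_Abelian_group (carrier G \<times> carrier H)"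
  let ?q = "\<lambda>c. tensor_kernel G H #>\<^bsub>?F\<^esub> c"
  interpret F: group ?F by simp
  interpret T: comm_group "tensor_group G H" by (intro comm_group_tensor_group assms)
  interpret q: group_hom ?F "tensor_group G H" ?q
    using tensor_quotient_hom[OF assms(1,2)] by unfold_locales
  let ?r = "frag_of z - frag_of x - frag_of y"
  have r: "?r \<in> tensor_kernel G H"
    unfolding tensor_kernel_def by (rule generate.incl) (rule assms)
  have rF: "?r \<in> carrier ?F"
    using tensor_relations_subset assms(1,2,6) by blast
  have "?q ?r = \<one>\<^bsub>tensor_group G H\<^esub>"
    unfolding tensor_group_def one_FactGroup
    using rF r F.coset_join2 normal_imp_subgroup[OF normal_tensor_kernel[OF assms(1,2)]] by blast
  moreover have xF: "frag_of x \<in> carrier ?F" and yF: "frag_of y \<in> carrier ?F"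
    using assms by auto
  \<comment> \<open>In the free group, z is the relation times x times y; the quotient map sends the
    first factor to the identity.\<close>
  moreover have "frag_of z = ?r \<otimes>\<^bsub>?F\<^esub> (frag_of x \<otimes>\<^bsub>?F\<^esub> frag_of y)"
    by simp
  ultimately have "?q (frag_of z) = ?q (frag_of x) \<otimes>\<^bsub>tensor_group G H\<^esub> ?q (frag_of y)"
    using rF by (metis F.m_closed q.hom_closed q.hom_mult T.l_one)
  then show ?thesis
    by (simp add: pure_tensor_def split_beta)
qed

lemma pure_tensor_hom_left:
  assumes "group G" "group H" "y \<in> carrier H"
  shows "(\<lambda>x. pure_tensor G H x y) \<in> hom G (tensor_group G H)"
proof (rule homI)
  interpret G: group G by fact
  show "pure_tensor G H x y \<in> carrier (tensor_group G H)" if "x \<in> carrier G" for x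
    using that assms by (intro pure_tensor_closed)
  show "pure_tensor G H (x \<otimes>\<^bsub>G\<^esub> x') y =
      pure_tensor G H x y \<otimes>\<^bsub>tensor_group G H\<^esub> pure_tensor G H x' y"
    if "x \<in> carrier G" "x' \<in> carrier G" for x x'
  proof -
    have "frag_of (x \<otimes>\<^bsub>G\<^esub> x', y) - frag_of (x, y) - frag_of (x', y) \<in> tensor_relations G H"
      unfolding tensor_relations_def using that assms(3) by blast
    from pure_tensor_relation[OF assms(1,2) _ _ _ this] that assms(3) show ?thesis
      by simp
  qed
qed

lemma pure_tensor_hom_right:
  assumes "group G" "group H" "x \<in> carrier G"
  shows "(\<lambda>y. pure_tensor G H x y) \<in> hom H (tensor_group G H)"
proof (rule homI)
  interpret H: group H by fact
  show "pure_tensor G H x y \<in> carrier (tensor_group G H)" if "y \<in> carrier H" for y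
    using that assms by (intro pure_tensor_closed)
  show "pure_tensor G H x (y \<otimes>\<^bsub>H\<^esub> y') =
      pure_tensor G H x y \<otimes>\<^bsub>tensor_group G H\<^esub> pure_tensor G H x y'"
    if "y \<in> carrier H" "y' \<in> carrier H" for y y'
  proof -
    have "frag_of (x, y \<otimes>\<^bsub>H\<^esub> y') - frag_of (x, y) - frag_of (x, y') \<in> tensor_relations G H"
      unfolding tensor_relations_def using that assms(3) by blast
    from pure_tensor_relation[OF assms(1,2) _ _ _ this] that assms(3) show ?thesis
      by simp
  qed
qed

text \<open>Uniqueness half of the universal property: every element is the coset of a finite
  integer combination of pairs, so the pure tensors generate the group.\<close>

lemma hom_tensor_group_eqI:
  assumes "group G" "group H" "group K"
    and "h \<in> hom (tensor_group G H) K" "k \<in> hom (tensor_group G H) K"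
    and eq: "\<And>x y. x \<in> carrier G \<Longrightarrow> y \<in> carrier H \<Longrightarrow>
      h (pure_tensor G H x y) = k (pure_tensor G H x y)"
    and "t \<in> carrier (tensor_group G H)"
  shows "h t = k t"
proof -
  let ?F = "free_Abelian_group (carrier G \<times> carrier H)"
  let ?q = "\<lambda>c. tensor_kernel G H #>\<^bsub>?F\<^esub> c"
  interpret F: group ?F by simp
  interpret K: group K by fact
  \<comment> \<open>Composing with the coset map \<open>?q\<close> moves the comparison to the free
    abelian group, where induction over zero, generators and differences is available.\<close>
  interpret h: group_hom ?F K "h \<circ> ?q"
    using hom_compose[OF tensor_quotient_hom[OF assms(1,2)] assms(4)] by unfold_locales
  interpret k: group_hom ?F K "k \<circ> ?q"
    using hom_compose[OF tensor_quotient_hom[OF assms(1,2)] assms(5)] by unfold_locales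
  obtain c where t: "t = ?q c" and c: "Poly_Mapping.keys c \<subseteq> carrier G \<times> carrier H"
    using assms(7) unfolding tensor_group_def carrier_FactGroup by auto
  from c have "(h \<circ> ?q) c = (k \<circ> ?q) c"
  proof (rule free_Abelian_group_induct)
    show "(h \<circ> ?q) 0 = (k \<circ> ?q) 0"
      using h.hom_one k.hom_one by simp
    show "(h \<circ> ?q) (a - b) = (k \<circ> ?q) (a - b)"
      if "Poly_Mapping.keys a \<subseteq> carrier G \<times> carrier H" "Poly_Mapping.keys b \<subseteq> carrier G \<times> carrier H"
        "(h \<circ> ?q) a = (k \<circ> ?q) a" "(h \<circ> ?q) b = (k \<circ> ?q) b" for a b
    proof -
      \<comment> \<open>The difference is written with the group operation and inverse so that the
        homomorphism laws apply; the simp rules deleted below would turn it back into a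
        difference.\<close>
      have "a - b = a \<otimes>\<^bsub>?F\<^esub> inv\<^bsub>?F\<^esub> b"
        using that by simp
      then show ?thesis
        using that h.hom_mult[of a "inv\<^bsub>?F\<^esub> b"] k.hom_mult[of a "inv\<^bsub>?F\<^esub> b"]
          h.hom_inv[of b] k.hom_inv[of b] F.inv_closed[of b]
        by (simp del: inv_free_Abelian_group mult_free_Abelian_group)
    qed
    show "(h \<circ> ?q) (frag_of p) = (k \<circ> ?q) (frag_of p)" if "p \<in> carrier G \<times> carrier H" for p
      using that eq by (auto simp: pure_tensor_def)
  qed
  then show ?thesis
    by (simp add: t)
qed

text \<open>Existence half of the universal property: extend \<open>f\<close> from pairs to the free
  abelian group. Biadditivity puts every relation into the kernel of the extension, which therefore
  factors through the quotient.\<close>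

lemma tensor_group_universal:
  assumes "group G" "group H" "comm_group K"
    and left: "\<And>y. y \<in> carrier H \<Longrightarrow> (\<lambda>x. f x y) \<in> hom G K"
    and right: "\<And>x. x \<in> carrier G \<Longrightarrow> (\<lambda>y. f x y) \<in> hom H K"
  obtains h where "h \<in> hom (tensor_group G H) K"
    and "\<And>x y. x \<in> carrier G \<Longrightarrow> y \<in> carrier H \<Longrightarrow> h (pure_tensor G H x y) = f x y"
proof -
  let ?F = "free_Abelian_group (carrier G \<times> carrier H)"
  interpret F: comm_group ?F by (rule abelian_free_Abelian_group)
  interpret G: group G by fact
  interpret H: group H by fact
  interpret K: comm_group K by fact
  have closed: "f x y \<in> carrier K" if "x \<in> carrier G" "y \<in> carrier H" for x y
    using left[OF that(2)] that(1) by (rule hom_in_carrier)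
  then have "case_prod f ` (carrier G \<times> carrier H) \<subseteq> carrier K"
    by auto
  from K.free_Abelian_group_universal[OF this] obtain h where h: "h \<in> hom ?F K"
    and h_frag: "\<And>p. p \<in> carrier G \<times> carrier H \<Longrightarrow> h (frag_of p) = case_prod f p"
    by blast
  interpret h: group_hom ?F K h
    using h by unfold_locales
  have rel: "frag_of z - frag_of x - frag_of y \<in> kernel ?F K h"
    if "x \<in> carrier G \<times> carrier H" "y \<in> carrier G \<times> carrier H" "z \<in> carrier G \<times> carrier H"
      and "case_prod f z = case_prod f x \<otimes>\<^bsub>K\<^esub> case_prod f y" for x y z
  proof -
    have F: "frag_of x \<in> carrier ?F" "frag_of y \<in> carrier ?F" "frag_of z \<in> carrier ?F"
      using that by auto
    \<comment> \<open>Since the free group is abelian, z - x - y is z times the inverse of the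
      product of x and y, which \<open>h\<close> maps to a quotient of equal elements.\<close>
    then have eq: "frag_of z - frag_of x - frag_of y =
        frag_of z \<otimes>\<^bsub>?F\<^esub> inv\<^bsub>?F\<^esub> (frag_of x \<otimes>\<^bsub>?F\<^esub> frag_of y)"
      using F.m_closed[OF F(1,2)] by simp
    have "h (frag_of z \<otimes>\<^bsub>?F\<^esub> inv\<^bsub>?F\<^esub> (frag_of x \<otimes>\<^bsub>?F\<^esub> frag_of y)) =
        h (frag_of z) \<otimes>\<^bsub>K\<^esub> inv\<^bsub>K\<^esub> (h (frag_of x) \<otimes>\<^bsub>K\<^esub> h (frag_of y))"
      using F h.hom_mult h.hom_inv F.m_closed F.inv_closed by metis
    also have "\<dots> = \<one>\<^bsub>K\<^esub>"
      using that F h_frag h.hom_closed by (metis K.r_inv)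
    finally show ?thesis
      using F unfolding kernel_def eq by blast
  qed
  have "tensor_relations G H \<subseteq> kernel ?F K h"
    unfolding tensor_relations_def
    by (auto intro!: rel simp: hom_mult[OF left] hom_mult[OF right])
  then have "tensor_kernel G H \<subseteq> kernel ?F K h"
    unfolding tensor_kernel_def
    by (intro F.generate_subgroup_incl h.subgroup_kernel)
  from h.FactGroup_universal_kernel[OF normal_tensor_kernel[OF assms(1,2)] this]
  obtain g where g: "g \<in> hom (tensor_group G H) K"
    and "\<And>c. c \<in> carrier ?F \<Longrightarrow> g (tensor_kernel G H #>\<^bsub>?F\<^esub> c) = h c"
    unfolding tensor_group_def by blast
  then have "g (pure_tensor G H x y) = f x y" if "x \<in> carrier G" "y \<in> carrier H" for x y
    using that h_frag by (simp add: pure_tensor_def)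
  with g that show ?thesis
    by blast
qed

text \<open>Functoriality of the tensor product: sending (x, y) to the pure tensor of
  \<open>f x\<close> and \<open>g y\<close> is biadditive, since a homomorphism followed by a
  homomorphism is one in each variable.\<close>

lemma tensor_group_map:
  assumes "group G" "group H" "group G'" "group H'" "f \<in> hom G G'" "g \<in> hom H H'"
  obtains h where "h \<in> hom (tensor_group G H) (tensor_group G' H')"
    and "\<And>x y. x \<in> carrier G \<Longrightarrow> y \<in> carrier H \<Longrightarrow>
      h (pure_tensor G H x y) = pure_tensor G' H' (f x) (g y)"
proof (rule tensor_group_universal[OF assms(1,2) comm_group_tensor_group[OF assms(3,4)]])
  show "(\<lambda>x. pure_tensor G' H' (f x) (g y)) \<in> hom G (tensor_group G' H')" if "y \<in> carrier H" for y
    using hom_compose[OF assms(5) pure_tensor_hom_left[OF assms(3,4) hom_in_carrier[OF assms(6) that]]]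
    by (simp add: o_def)
  show "(\<lambda>y. pure_tensor G' H' (f x) (g y)) \<in> hom H (tensor_group G' H')" if "x \<in> carrier G" for x
    using hom_compose[OF assms(6) pure_tensor_hom_right[OF assms(3,4) hom_in_carrier[OF assms(5) that]]]
    by (simp add: o_def)
qed (use that in blast)

text \<open>The inverse is the map induced by \<open>f'\<close> and \<open>g'\<close>. Both
  composites fix pure tensors, so by uniqueness they agree with the identity everywhere.\<close>

lemma tensor_group_iso:
  assumes grp: "group G" "group H" "group G'" "group H'"
    and f: "f \<in> hom G G'" "f' \<in> hom G' G"
      "\<And>x. x \<in> carrier G \<Longrightarrow> f' (f x) = x" "\<And>x. x \<in> carrier G' \<Longrightarrow> f (f' x) = x"
    and g: "g \<in> hom H H'" "g' \<in> hom H' H"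
      "\<And>y. y \<in> carrier H \<Longrightarrow> g' (g y) = y" "\<And>y. y \<in> carrier H' \<Longrightarrow> g (g' y) = y"
  obtains h where "h \<in> iso (tensor_group G H) (tensor_group G' H')"
    and "\<And>x y. x \<in> carrier G \<Longrightarrow> y \<in> carrier H \<Longrightarrow>
      h (pure_tensor G H x y) = pure_tensor G' H' (f x) (g y)"
proof -
  obtain h where h: "h \<in> hom (tensor_group G H) (tensor_group G' H')"
    and h_pure: "\<And>x y. x \<in> carrier G \<Longrightarrow> y \<in> carrier H \<Longrightarrow>
      h (pure_tensor G H x y) = pure_tensor G' H' (f x) (g y)"
    using tensor_group_map[OF grp f(1) g(1)] by blast
  obtain k where k: "k \<in> hom (tensor_group G' H') (tensor_group G H)"
    and k_pure: "\<And>x y. x \<in> carrier G' \<Longrightarrow> y \<in> carrier H' \<Longrightarrow>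
      k (pure_tensor G' H' x y) = pure_tensor G H (f' x) (g' y)"
    using tensor_group_map[OF grp(3,4,1,2) f(2) g(2)] by blast
  have T: "group (tensor_group G H)" "group (tensor_group G' H')"
    using comm_group_tensor_group grp by (blast dest: comm_group.axioms(2))+
  have id_hom: "(\<lambda>x. x) \<in> hom K K" for K :: "('x, 'y) monoid_scheme"
    by (simp add: hom_def)
  have "h \<in> iso (tensor_group G H) (tensor_group G' H')"
  proof (rule iso_of_inverse_homs[OF h k])
    show "k (h t) = t" if "t \<in> carrier (tensor_group G H)" for t
      using hom_tensor_group_eqI[OF grp(1,2) T(1) hom_compose[OF h k] id_hom _ that]
        h_pure k_pure f g by (simp add: hom_in_carrier[OF f(1)] hom_in_carrier[OF g(1)])
    show "h (k t) = t" if "t \<in> carrier (tensor_group G' H')" for t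
      using hom_tensor_group_eqI[OF grp(3,4) T(2) hom_compose[OF k h] id_hom _ that]
        h_pure k_pure f g by (simp add: hom_in_carrier[OF f(2)] hom_in_carrier[OF g(2)])
  qed
  with h_pure that show ?thesis
    by blast
qed

section \<open>Homomorphisms on integer vectors\<close>

text \<open>Bridge between the two notations for integer multiples: homomorphisms are known to
  respect group powers, while matrix computations produce scalar multiples.\<close>

lemma int_pow_monoid_vec:
  assumes "v \<in> carrier_vec n"
  shows "v [^]\<^bsub>monoid_vec TYPE(int) n\<^esub> (a::int) = a \<cdot>\<^sub>v v"
proof -
  interpret V: comm_group "monoid_vec TYPE(int) n" by (rule comm_group_vec)
  have nat: "v [^]\<^bsub>monoid_vec TYPE(int) n\<^esub> (k::nat) = int k \<cdot>\<^sub>v v" for k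
    using assms by (induction k) (auto simp: monoid_vec_simps algebra_simps)
  have inv: "inv\<^bsub>monoid_vec TYPE(int) n\<^esub> w = - w" if "w \<in> carrier_vec n" for w
    using that by (intro V.inv_equality) (auto simp: monoid_vec_simps)
  show ?thesis
    using assms by (cases a rule: int_cases2)
      (auto simp: V.int_pow_neg int_pow_int nat inv monoid_vec_simps)
qed

text \<open>The standard basis generates the group of integer vectors, with the coordinates of
  \<open>v\<close> as exponents. The proof builds \<open>v\<close> up one coordinate at a
  time.\<close>

lemma hom_vec_expand:
  assumes "comm_group K" "h \<in> hom (monoid_vec TYPE(int) n) K" "v \<in> carrier_vec n"
  shows "h v = finprod K (\<lambda>i. h (unit_vec n i) [^]\<^bsub>K\<^esub> (v $ i)) {..<n}"
proof -
  let ?V = "monoid_vec TYPE(int) n"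
  interpret V: comm_group ?V by (rule comm_group_vec)
  interpret K: comm_group K by fact
  interpret h: group_hom ?V K h
    using assms(2) by unfold_locales
  \<comment> \<open>The truncation of \<open>v\<close> to its first \<open>m\<close> coordinates:
    \<open>p 0\<close> is the zero vector, \<open>p n\<close> is \<open>v\<close>, and passing from
    \<open>m\<close> to \<open>Suc m\<close> adds the multiple \<open>v $ m\<close> of the basis
    vector with index \<open>m\<close>.\<close>
  define p where "p m = vec n (\<lambda>i. if i < m then v $ i else 0)" for m
  have "h (p m) = finprod K (\<lambda>i. h (unit_vec n i) [^]\<^bsub>K\<^esub> (v $ i)) {..<m}" if "m \<le> n" for m
    using that
  proof (induction m)
    case 0
    have "p 0 = \<one>\<^bsub>?V\<^esub>"
      by (auto simp: p_def monoid_vec_simps)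
    then show ?case by simp
  next
    case (Suc m)
    have "p (Suc m) = unit_vec n m [^]\<^bsub>?V\<^esub> (v $ m) \<otimes>\<^bsub>?V\<^esub> p m"
      using Suc.prems by (intro eq_vecI) (auto simp: p_def int_pow_monoid_vec monoid_vec_simps less_Suc_eq)
    moreover have "p m \<in> carrier ?V" "unit_vec n i \<in> carrier ?V" for i
      by (auto simp: p_def monoid_vec_simps)
    ultimately show ?case
      using Suc by (simp add: lessThan_Suc h.hom_int_pow Pi_iff)
  qed
  moreover have "p n = v"
    using assms(3) by (intro eq_vecI) (auto simp: p_def)
  ultimately show ?thesis
    by blast
qed

text \<open>Both sides expand to the same double sum, over i and j, of \<open>R $$ (i, j)\<close>
  times the value of \<open>c\<close> at the basis vectors i and j. This is what moves a matrix from
  one tensor factor to the other, and it changes the range of summation from \<open>n\<close> to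
  \<open>m\<close>.\<close>

lemma biadditive_transpose:
  fixes R :: "int mat"
  assumes "comm_group K" "R \<in> carrier_mat n m"
    and left: "\<And>y. y \<in> carrier_vec m \<Longrightarrow> (\<lambda>x. c x y) \<in> hom (monoid_vec TYPE(int) n) K"
    and right: "\<And>x. x \<in> carrier_vec n \<Longrightarrow> (\<lambda>y. c x y) \<in> hom (monoid_vec TYPE(int) m) K"
  shows "finprod K (\<lambda>i. c (unit_vec n i) (R\<^sup>T *\<^sub>v unit_vec n i)) {..<n} =
    finprod K (\<lambda>j. c (R *\<^sub>v unit_vec m j) (unit_vec m j)) {..<m}"
proof -
  interpret K: comm_group K by fact
  have c: "c x y \<in> carrier K" if "x \<in> carrier_vec n" "y \<in> carrier_vec m" for x y
    using hom_in_carrier[OF left[OF that(2)]] that(1) by (simp add: monoid_vec_simps)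
  let ?t = "\<lambda>i j. c (unit_vec n i) (unit_vec m j) [^]\<^bsub>K\<^esub> (R $$ (i, j))"
  \<comment> \<open>The coordinates of \<open>R\<^sup>T *\<^sub>v unit_vec n i\<close> are row i of
    \<open>R\<close>; expansion is in the second variable.\<close>
  have row: "c (unit_vec n i) (R\<^sup>T *\<^sub>v unit_vec n i) = finprod K (?t i) {..<m}" if "i < n" for i
  proof -
    have "c (unit_vec n i) (R\<^sup>T *\<^sub>v unit_vec n i) =
      finprod K (\<lambda>j. c (unit_vec n i) (unit_vec m j) [^]\<^bsub>K\<^esub> ((R\<^sup>T *\<^sub>v unit_vec n i) $ j)) {..<m}"
      using assms(1,2) by (intro hom_vec_expand right) auto
    also have "\<dots> = finprod K (?t i) {..<m}"
      using assms(2) that by (intro K.finprod_cong') (auto intro!: c)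
    finally show ?thesis .
  qed
  \<comment> \<open>Dually, the coordinates of \<open>R *\<^sub>v unit_vec m j\<close> are column j
    of \<open>R\<close>; expansion is in the first variable.\<close>
  have col: "c (R *\<^sub>v unit_vec m j) (unit_vec m j) = finprod K (\<lambda>i. ?t i j) {..<n}" if "j < m" for j
  proof -
    have "c (R *\<^sub>v unit_vec m j) (unit_vec m j) =
      finprod K (\<lambda>i. c (unit_vec n i) (unit_vec m j) [^]\<^bsub>K\<^esub> ((R *\<^sub>v unit_vec m j) $ i)) {..<n}"
      using assms(1,2) by (intro hom_vec_expand[where h = "\<lambda>x. c x (unit_vec m j)"] left) auto
    also have "\<dots> = finprod K (\<lambda>i. ?t i j) {..<n}"
      using assms(2) that by (intro K.finprod_cong') (auto intro!: c)
    finally show ?thesis .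
  qed
  have "finprod K (\<lambda>i. c (unit_vec n i) (R\<^sup>T *\<^sub>v unit_vec n i)) {..<n} =
      finprod K (\<lambda>i. finprod K (?t i) {..<m}) {..<n}"
    using row by (intro K.finprod_cong') (auto intro!: c K.finprod_closed)
  also have "\<dots> = finprod K (\<lambda>j. finprod K (\<lambda>i. ?t i j) {..<n}) {..<m}"
    by (intro K.finprod_swap) (auto intro!: c)
  also have "\<dots> = finprod K (\<lambda>j. c (R *\<^sub>v unit_vec m j) (unit_vec m j)) {..<m}"
    using col assms(2) by (intro K.finprod_cong') (auto intro!: c)
  finally show ?thesis .
qed

section \<open>Cokernels\<close>

lemma id_minus_mult_closed:
  fixes A :: "int mat"
  assumes "A \<in> carrier_mat n n" "v \<in> carrier_vec n"
  shows "(1\<^sub>m n - A) *\<^sub>v v \<in> carrier_vec n"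
  using assms by (intro mult_mat_vec_carrier[of _ n n]) auto

text \<open>The range is the image of an endomorphism of an abelian group, hence a subgroup, and
  every subgroup there is normal.\<close>

lemma normal_id_minus_range:
  assumes "A \<in> carrier_mat n n"
  shows "id_minus_range n A \<lhd> monoid_vec TYPE(int) n"
proof -
  let ?V = "monoid_vec TYPE(int) n"
  interpret V: comm_group ?V by (rule comm_group_vec)
  have "(\<lambda>v. (1\<^sub>m n - A) *\<^sub>v v) \<in> hom ?V ?V"
    using assms by (auto simp: hom_def monoid_vec_simps id_minus_mult_closed
        intro!: mult_add_distrib_mat_vec)
  then interpret group_hom ?V ?V "\<lambda>v. (1\<^sub>m n - A) *\<^sub>v v"
    by unfold_locales
  show ?thesis
    using img_is_subgroup V.subgroup_imp_normal by (simp add: id_minus_range_def monoid_vec_simps)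
qed

lemma group_coker_group:
  assumes "A \<in> carrier_mat n n"
  shows "group (coker_group n A)"
  unfolding coker_group_def by (rule normal.factorgroup_is_group[OF normal_id_minus_range[OF assms]])

lemma coker_class_hom:
  assumes "A \<in> carrier_mat n n"
  shows "coker_class n A \<in> hom (monoid_vec TYPE(int) n) (coker_group n A)"
  using normal.r_coset_hom_Mod[OF normal_id_minus_range[OF assms]]
  unfolding coker_class_def[abs_def] coker_group_def .

lemma coker_class_closed:
  assumes "A \<in> carrier_mat n n" "v \<in> carrier_vec n"
  shows "coker_class n A v \<in> carrier (coker_group n A)"
  using hom_in_carrier[OF coker_class_hom[OF assms(1)]] assms(2) by (simp add: monoid_vec_simps)

lemma coker_groupE:
  assumes "x \<in> carrier (coker_group n A)"
  obtains v where "v \<in> carrier_vec n" "x = coker_class n A v"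
  using assms unfolding coker_group_def carrier_FactGroup coker_class_def
  by (auto simp: monoid_vec_simps)

lemma coker_class_id_minus:
  assumes "A \<in> carrier_mat n n" "v \<in> carrier_vec n"
  shows "coker_class n A ((1\<^sub>m n - A) *\<^sub>v v) = \<one>\<^bsub>coker_group n A\<^esub>"
proof -
  interpret V: comm_group "monoid_vec TYPE(int) n" by (rule comm_group_vec)
  show ?thesis
    unfolding coker_class_def coker_group_def one_FactGroup
    using assms normal_imp_subgroup[OF normal_id_minus_range[OF assms(1)]]
    by (intro V.coset_join2) (auto simp: monoid_vec_simps id_minus_range_def id_minus_mult_closed)
qed

text \<open>The vectors \<open>v\<close> and \<open>A *\<^sub>v v\<close> differ by
  \<open>(1\<^sub>m n - A) *\<^sub>v v\<close>, whose class is trivial.\<close>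

lemma coker_class_mult:
  assumes "A \<in> carrier_mat n n" "v \<in> carrier_vec n"
  shows "coker_class n A (A *\<^sub>v v) = coker_class n A v"
proof -
  interpret Q: group "coker_group n A" by (rule group_coker_group[OF assms(1)])
  have "v = A *\<^sub>v v + (1\<^sub>m n - A) *\<^sub>v v"
    using assms by (subst minus_mult_distrib_mat_vec[of _ n n]) auto
  then have "coker_class n A v =
      coker_class n A (A *\<^sub>v v) \<otimes>\<^bsub>coker_group n A\<^esub> coker_class n A ((1\<^sub>m n - A) *\<^sub>v v)"
    using hom_mult[OF coker_class_hom[OF assms(1)], of "A *\<^sub>v v" "(1\<^sub>m n - A) *\<^sub>v v"] assms
    by (simp add: monoid_vec_simps id_minus_mult_closed)
  then show ?thesis
    using assms by (simp add: coker_class_id_minus coker_class_closed)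
qed

text \<open>Iterates the previous fact. It is the reason why matrices whose product is a power of
  \<open>A\<close> induce mutually inverse maps on classes.\<close>

lemma coker_class_pow:
  assumes "A \<in> carrier_mat n n" "v \<in> carrier_vec n"
  shows "coker_class n A ((A ^\<^sub>m l) *\<^sub>v v) = coker_class n A v"
  using assms(2)
proof (induction l arbitrary: v)
  case 0
  then show ?case using assms(1) by simp
next
  case (Suc l)
  have "(A ^\<^sub>m Suc l) *\<^sub>v v = (A ^\<^sub>m l) *\<^sub>v (A *\<^sub>v v)"
    using assms(1) Suc.prems by (simp add: assoc_mult_mat_vec[of _ n n _ n])
  then show ?case
    using assms(1) Suc by (simp add: coker_class_mult)
qed

section \<open>Transposed powers and maps of cokernels induced by intertwining matrices\<close>

lemma transpose_pow_mat:
  fixes A :: "int mat"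
  assumes "A \<in> carrier_mat n n"
  shows "(A ^\<^sub>m l)\<^sup>T = A\<^sup>T ^\<^sub>m l"
proof (induction l)
  case 0
  then show ?case using assms by simp
next
  case (Suc l)
  \<comment> \<open>Powers unfold with the new factor on the right, and transposition reverses
    products; peeling \<open>A\<close> off on the left makes the transpose match the unfolding of
    \<open>A\<^sup>T ^\<^sub>m Suc l\<close>.\<close>
  have "A ^\<^sub>m Suc l = A * A ^\<^sub>m l"
    using assms by (induction l) (auto simp: assoc_mult_mat[of _ n n _ n _ n])
  then show ?case
    using assms Suc by (simp add: transpose_mult[of A n n "A ^\<^sub>m l" n])
qed

text \<open>From \<open>P * A = B * P\<close> follows P (1 - A) = (1 - B) P, so \<open>P\<close>
  carries the range of 1 - A into that of 1 - B, and v to the class of P v factors through the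
  cokernel.\<close>

lemma coker_map:
  assumes "A \<in> carrier_mat n n" "B \<in> carrier_mat m m" "P \<in> carrier_mat m n" "P * A = B * P"
  obtains f where "f \<in> hom (coker_group n A) (coker_group m B)"
    and "\<And>v. v \<in> carrier_vec n \<Longrightarrow> f (coker_class n A v) = coker_class m B (P *\<^sub>v v)"
proof -
  let ?V = "monoid_vec TYPE(int) n"
  let ?h = "\<lambda>v. coker_class m B (P *\<^sub>v v)"
  interpret V: comm_group ?V by (rule comm_group_vec)
  interpret Q: group "coker_group m B" by (rule group_coker_group[OF assms(2)])
  have "(\<lambda>v. P *\<^sub>v v) \<in> hom ?V (monoid_vec TYPE(int) m)"
    using assms(3) by (auto simp: hom_def monoid_vec_simps intro!: mult_add_distrib_mat_vec)
  from hom_compose[OF this coker_class_hom[OF assms(2)]]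
  interpret h: group_hom ?V "coker_group m B" ?h
    by unfold_locales (simp add: o_def)
  have "?h ((1\<^sub>m n - A) *\<^sub>v v) = \<one>\<^bsub>coker_group m B\<^esub>" if v: "v \<in> carrier_vec n" for v
  proof -
    have "P *\<^sub>v ((1\<^sub>m n - A) *\<^sub>v v) = (P * (1\<^sub>m n - A)) *\<^sub>v v"
      using assms v by (intro assoc_mult_mat_vec[symmetric]) auto
    also have "P * (1\<^sub>m n - A) = (1\<^sub>m m - B) * P"
      using assms by (simp add: mult_minus_distrib_mat[of P m n _ n] minus_mult_distrib_mat[of _ m m _ P n])
    also have "\<dots> *\<^sub>v v = (1\<^sub>m m - B) *\<^sub>v (P *\<^sub>v v)"
      using assms v by (intro assoc_mult_mat_vec) auto
    finally show ?thesis
      using assms v by (simp add: coker_class_id_minus)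
  qed
  then have "id_minus_range n A \<subseteq> kernel ?V (coker_group m B) ?h"
    using assms(1) by (auto simp: kernel_def id_minus_range_def monoid_vec_simps id_minus_mult_closed)
  from h.FactGroup_universal_kernel[OF normal_id_minus_range[OF assms(1)] this]
  show ?thesis
    using that unfolding coker_group_def[symmetric] coker_class_def[symmetric] monoid_vec_simps
    by blast
qed

text \<open>On representatives the round trip is multiplication by \<open>Q * P\<close>, a power of
  \<open>A\<close>, which leaves classes unchanged. Stated for one direction only, so that it covers
  all four round trips of a shift equivalence.\<close>

lemma coker_maps_inverse:
  assumes "A \<in> carrier_mat n n" "P \<in> carrier_mat m n" "Q \<in> carrier_mat n m" "Q * P = A ^\<^sub>m l"
    and "\<And>v. v \<in> carrier_vec n \<Longrightarrow> f (coker_class n A v) = coker_class m B (P *\<^sub>v v)"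
    and "\<And>v. v \<in> carrier_vec m \<Longrightarrow> g (coker_class m B v) = coker_class n A (Q *\<^sub>v v)"
    and "x \<in> carrier (coker_group n A)"
  shows "g (f x) = x"
proof -
  obtain v where v: "v \<in> carrier_vec n" "x = coker_class n A v"
    using assms(7) by (rule coker_groupE)
  have "g (f x) = coker_class n A (Q *\<^sub>v (P *\<^sub>v v))"
    using assms v by simp
  also have "Q *\<^sub>v (P *\<^sub>v v) = (A ^\<^sub>m l) *\<^sub>v v"
    using assms(2-4) v by (metis assoc_mult_mat_vec)
  finally show ?thesis
    using assms v by (simp add: coker_class_pow)
qed

section \<open>Invariance of the tensor product and its distinguished element\<close>

theorem proposition5p5:
  fixes N M :: nat and A B :: "int mat"
  assumes "A \<in> carrier_mat N N" and "B \<in> carrier_mat M M"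
    and "elements_mat A \<subseteq> {0, 1}" and "elements_mat B \<subseteq> {0, 1}"
    and "irreducible_matrix N A" and "irreducible_matrix M B"
    and "\<not> permutation_matrix N A" and "\<not> permutation_matrix M B"
    and "shift_equivalent N A M B"
  shows "\<exists>\<phi> \<in> iso (coker_tensor N A) (coker_tensor M B). \<phi> (e_elem N A) = e_elem M B"
proof -
  note A = assms(1) and B = assms(2)
  have At: "A\<^sup>T \<in> carrier_mat N N" and Bt: "B\<^sup>T \<in> carrier_mat M M"
    using A B by auto
  obtain l R S where R: "R \<in> carrier_mat N M" and S: "S \<in> carrier_mat M N"
    and AR: "A * R = R * B" and SA: "S * A = B * S"
    and RS: "A ^\<^sub>m l = R * S" and SR: "B ^\<^sub>m l = S * R"
    using assms(9) unfolding shift_equivalent_def by blast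
  have Rt: "R\<^sup>T \<in> carrier_mat M N" and St: "S\<^sup>T \<in> carrier_mat N M"
    using R S by auto
  \<comment> \<open>Transposing reverses the intertwining relations, so \<open>R\<^sup>T\<close>
    maps the transposed side in the same direction, from \<open>N\<close> to \<open>M\<close>, as
    \<open>S\<close> maps the original side; \<open>S\<^sup>T\<close> accompanies \<open>R\<close>
    on the way back.\<close>
  have RtAt: "R\<^sup>T * A\<^sup>T = B\<^sup>T * R\<^sup>T"
    using AR A B R by (metis transpose_mult)
  have AtSt: "S\<^sup>T * B\<^sup>T = A\<^sup>T * S\<^sup>T"
    using SA A B S by (metis transpose_mult)
  have StRt: "S\<^sup>T * R\<^sup>T = A\<^sup>T ^\<^sub>m l"
    using RS R S A by (metis transpose_mult transpose_pow_mat)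
  have RtSt: "R\<^sup>T * S\<^sup>T = B\<^sup>T ^\<^sub>m l"
    using SR R S B by (metis transpose_mult transpose_pow_mat)
  let ?G = "coker_group N A" and ?H = "coker_group N A\<^sup>T"
  let ?G' = "coker_group M B" and ?H' = "coker_group M B\<^sup>T"
  note grp = group_coker_group[OF A] group_coker_group[OF At]
    group_coker_group[OF B] group_coker_group[OF Bt]
  obtain f where f: "f \<in> hom ?G ?G'"
    and f_class: "\<And>v. v \<in> carrier_vec N \<Longrightarrow> f (coker_class N A v) = coker_class M B (S *\<^sub>v v)"
    using coker_map[OF A B S SA] by blast
  obtain f' where f': "f' \<in> hom ?G' ?G"
    and f'_class: "\<And>v. v \<in> carrier_vec M \<Longrightarrow> f' (coker_class M B v) = coker_class N A (R *\<^sub>v v)"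
    using coker_map[OF B A R AR[symmetric]] by blast
  obtain g where g: "g \<in> hom ?H ?H'"
    and g_class: "\<And>v. v \<in> carrier_vec N \<Longrightarrow> g (coker_class N A\<^sup>T v) = coker_class M B\<^sup>T (R\<^sup>T *\<^sub>v v)"
    using coker_map[OF At Bt Rt RtAt] by blast
  obtain g' where g': "g' \<in> hom ?H' ?H"
    and g'_class: "\<And>v. v \<in> carrier_vec M \<Longrightarrow> g' (coker_class M B\<^sup>T v) = coker_class N A\<^sup>T (S\<^sup>T *\<^sub>v v)"
    using coker_map[OF Bt At St AtSt] by blast
  \<comment> \<open>The four round trips are multiplication by \<open>R * S\<close>,
    \<open>S * R\<close>, \<open>S\<^sup>T * R\<^sup>T\<close> and
    \<open>R\<^sup>T * S\<^sup>T\<close>, each an l-th power of the matrix defining the respective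
    cokernel.\<close>
  have inverses: "\<And>x. x \<in> carrier ?G \<Longrightarrow> f' (f x) = x" "\<And>x. x \<in> carrier ?G' \<Longrightarrow> f (f' x) = x"
    "\<And>y. y \<in> carrier ?H \<Longrightarrow> g' (g y) = y" "\<And>y. y \<in> carrier ?H' \<Longrightarrow> g (g' y) = y"
    by (rule coker_maps_inverse[OF A S R RS[symmetric] f_class f'_class]
        coker_maps_inverse[OF B R S SR[symmetric] f'_class f_class]
        coker_maps_inverse[OF At Rt St StRt g_class g'_class]
        coker_maps_inverse[OF Bt St Rt RtSt g'_class g_class]; assumption)+
  obtain \<phi> where \<phi>: "\<phi> \<in> iso (tensor_group ?G ?H) (tensor_group ?G' ?H')"
    and \<phi>_pure: "\<And>x y. x \<in> carrier ?G \<Longrightarrow> y \<in> carrier ?H \<Longrightarrow>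
      \<phi> (pure_tensor ?G ?H x y) = pure_tensor ?G' ?H' (f x) (g y)"
    using tensor_group_iso[OF grp f f' inverses(1,2) g g' inverses(3,4)] by blast
  let ?T = "tensor_group ?G ?H" and ?T' = "tensor_group ?G' ?H'"
  have T: "comm_group ?T" "comm_group ?T'"
    by (intro comm_group_tensor_group grp)+
  interpret T': comm_group ?T' by (rule T)
  \<comment> \<open>A biadditive pairing of vectors of lengths \<open>N\<close> and
    \<open>M\<close>. \<open>S\<close> is built into its first variable, so that
    \<open>R\<^sup>T\<close> is the only matrix left to move across.\<close>
  let ?c = "\<lambda>x y. pure_tensor ?G' ?H' (coker_class M B (S *\<^sub>v x)) (coker_class M B\<^sup>T y)"
  have "\<phi> (e_elem N A) = finprod ?T' (\<lambda>i. \<phi> (pure_tensor ?G ?H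
      (coker_class N A (unit_vec N i)) (coker_class N A\<^sup>T (unit_vec N i)))) {..<N}"
    unfolding e_elem_def coker_tensor_def
    using \<phi> by (intro hom_finprod T)
      (auto simp: iso_def intro!: pure_tensor_closed grp coker_class_closed A At)
  also have "\<dots> = finprod ?T' (\<lambda>i. ?c (unit_vec N i) (R\<^sup>T *\<^sub>v unit_vec N i)) {..<N}"
    using S Rt by (intro T'.finprod_cong')
      (auto simp: \<phi>_pure f_class g_class coker_class_closed A At
        intro!: pure_tensor_closed grp coker_class_closed B Bt)
  \<comment> \<open>\<open>R\<^sup>T\<close> in the second factor becomes \<open>R\<close> in the
    first, and the sum over \<open>N\<close> basis vectors becomes one over
    \<open>M\<close>.\<close>
  also have "\<dots> = finprod ?T' (\<lambda>k. ?c (R *\<^sub>v unit_vec M k) (unit_vec M k)) {..<M}"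
  proof (rule biadditive_transpose[OF T(2) R])
    have "(\<lambda>v. S *\<^sub>v v) \<in> hom (monoid_vec TYPE(int) N) (monoid_vec TYPE(int) M)"
      using S by (auto simp: hom_def monoid_vec_simps intro!: mult_add_distrib_mat_vec)
    note hS = hom_compose[OF this coker_class_hom[OF B]]
    show "(\<lambda>x. ?c x y) \<in> hom (monoid_vec TYPE(int) N) ?T'" if "y \<in> carrier_vec M" for y
      using hom_compose[OF hS pure_tensor_hom_left[OF grp(3,4) coker_class_closed[OF Bt that]]]
      by (simp add: o_def)
    show "(\<lambda>y. ?c x y) \<in> hom (monoid_vec TYPE(int) M) ?T'" if "x \<in> carrier_vec N" for x
      using hom_compose[OF coker_class_hom[OF Bt] pure_tensor_hom_right[OF grp(3,4)
            coker_class_closed[OF B mult_mat_vec_carrier[OF S that]]]]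
      by (simp add: o_def)
  qed
  also have "\<dots> = e_elem M B"
    unfolding e_elem_def coker_tensor_def
  proof (rule T'.finprod_cong')
    fix k
    \<comment> \<open>The first factor now carries \<open>S * R\<close>, a power of
      \<open>B\<close>, which disappears on classes modulo the range of 1 - B.\<close>
    have "S *\<^sub>v (R *\<^sub>v unit_vec M k) = (B ^\<^sub>m l) *\<^sub>v unit_vec M k"
      unfolding SR by (intro assoc_mult_mat_vec[OF S R, symmetric]) auto
    then show "?c (R *\<^sub>v unit_vec M k) (unit_vec M k) =
        pure_tensor ?G' ?H' (coker_class M B (unit_vec M k)) (coker_class M B\<^sup>T (unit_vec M k))"
      by (simp add: coker_class_pow B)
  qed (auto intro!: pure_tensor_closed grp coker_class_closed B Bt)
  finally show ?thesis
    using \<phi> unfolding coker_tensor_def by blast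
qed

end
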